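(* Let $n\ge 1$ and $r\ge 1$ be integers with $r<2n$, and let $1_n=(1,1,\ldots,1)\in\mathbb{N}_0^n$. Then $$c_{1_n}=(-1)^{\lfloor r/2\rfloor}\binom{n-1}{\lfloor r/2\rfloor}.$$
   Context: $\mathbb{N}_0=\{0,1,2,\ldots\}$. For $\alpha=(\alpha_1,\ldots,\alpha_n)\in\mathbb{N}_0^n$, $|\alpha|=\sum_{j=1}^n\alpha_j$ and the superlinear norm is $|\alpha|'=\sum_{j:\,\alpha_j\ge 2}\alpha_j$ (sum over those $j$ with $\alpha_j\ge2$; $0$ if there are none). Define $S_r=\{\alpha\in\mathbb{N}_0^n:|\alpha|'\le r\}$ and let $\chi(S_r):\mathbb{N}_0^n\to\{0,1\}$ be its characteristic function ($1$ on $S_r$, $0$ elsewhere). For $\alpha\in S_r$ define the integer $$c_\alpha=\sum_{\epsilon\in\{0,1\}^n}(-1)^{|\epsilon|}\,\chi(S_r)(\alpha+\epsilon).$$ (These are the coefficients expressing the interpolant on the lower set $S_r$ as a linear combination of tensor-product interpolants.) *)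

theory Defs
  imports Complex_Main "HOL-Library.FuncSet" "HOL-Library.Indicator_Function"
begin

text \<open>Multi-indices of length \<open>n\<close> are functions extensional on \<open>{1..n}\<close>, so that each element
  of \<open>\<nat>\<^sub>0\<^sup>n\<close> is represented by exactly one function and finite sums over sets of
  multi-indices count each index once. Sums of multi-indices are restricted accordingly.\<close>

definition multi_indices :: "nat \<Rightarrow> (nat \<Rightarrow> nat) set" where
  "multi_indices n = {1..n} \<rightarrow>\<^sub>E UNIV"

definition binary_multi_indices :: "nat \<Rightarrow> (nat \<Rightarrow> nat) set" where
  "binary_multi_indices n = {1..n} \<rightarrow>\<^sub>E {0, 1}"

definition mi_add :: "nat \<Rightarrow> (nat \<Rightarrow> nat) \<Rightarrow> (nat \<Rightarrow> nat) \<Rightarrow> (nat \<Rightarrow> nat)" where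
  "mi_add n \<alpha> \<beta> = (\<lambda>j\<in>{1..n}. \<alpha> j + \<beta> j)"

definition mi_ones :: "nat \<Rightarrow> (nat \<Rightarrow> nat)" where
  "mi_ones n = (\<lambda>j\<in>{1..n}. 1)"

definition mi_norm :: "nat \<Rightarrow> (nat \<Rightarrow> nat) \<Rightarrow> nat" where
  "mi_norm n \<alpha> = (\<Sum>j\<in>{1..n}. \<alpha> j)"

definition superlinear_norm :: "nat \<Rightarrow> (nat \<Rightarrow> nat) \<Rightarrow> nat" where
  "superlinear_norm n \<alpha> = (\<Sum>j\<in>{j\<in>{1..n}. \<alpha> j \<ge> 2}. \<alpha> j)"

definition superlinear_set :: "nat \<Rightarrow> nat \<Rightarrow> (nat \<Rightarrow> nat) set" where
  "superlinear_set n r = {\<alpha> \<in> multi_indices n. superlinear_norm n \<alpha> \<le> r}"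

definition interp_coeff :: "nat \<Rightarrow> nat \<Rightarrow> (nat \<Rightarrow> nat) \<Rightarrow> int" where
  "interp_coeff n r \<alpha> =
     (\<Sum>\<epsilon>\<in>binary_multi_indices n.
        (-1) ^ mi_norm n \<epsilon> * indicator (superlinear_set n r) (mi_add n \<alpha> \<epsilon>))"

end

theory Submission
  imports Defs
begin

text \<open>A binary \<epsilon> is the indicator of its support T. Adding it to the all-ones index
  gives entries 2 on T and 1 elsewhere, so the superlinear norm is 2|T| and the summand depends only
  on k = |T|: it is (-1)^k if 2k \<le> r and 0 otherwise. Counting the supports of each size
  (\<open>sum_Pow_card\<close>) leaves the alternating sum of n choose k over k \<le> r div 2, which
  telescopes by Pascal's rule (\<open>alternating_binomial_partial_sum\<close>).\<close>

lemma alternating_binomial_partial_sum: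
  fixes n m :: nat
  assumes "n \<ge> 1"
  shows "(\<Sum>k\<le>m. (-1) ^ k * int (n choose k)) = (-1) ^ m * int ((n - 1) choose m)"
proof (induction m)
  case (Suc m)
  \<comment> \<open>With \<open>n = Suc p\<close>, Pascal's rule splits
    \<open>n choose Suc m\<close>; its part \<open>p choose m\<close> cancels the inductive
    value.\<close>
  from assms obtain p where "n = Suc p" by (cases n) auto
  with Suc show ?case by (simp add: algebra_simps)
qed simp

lemma sum_Pow_card:
  fixes f :: "nat \<Rightarrow> 'b::semiring_1"
  assumes "finite A"
  shows "(\<Sum>T\<in>Pow A. f (card T)) = (\<Sum>k\<le>card A. of_nat (card A choose k) * f k)"
proof -
  have "(\<Sum>T\<in>Pow A. f (card T))
      = (\<Sum>k\<in>{..card A}. \<Sum>T\<in>{T \<in> Pow A. card T = k}. f (card T))"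
    by (rule sum.group [symmetric]) (use assms in \<open>auto intro: card_mono\<close>)
  also have "\<dots> = (\<Sum>k\<le>card A. of_nat (card A choose k) * f k)"
    using assms by (intro sum.cong) (simp_all add: n_subsets)
  finally show ?thesis .
qed

text \<open>The inverse takes the support of \<epsilon>. Extensionality makes this exact, since
  \<epsilon> is fixed outside \<open>{1..n}\<close>.\<close>

lemma bij_betw_indicator_Pow:
  "bij_betw (\<lambda>T. \<lambda>j\<in>{1..n}. if j \<in> T then 1 else 0) (Pow {1..n}) (binary_multi_indices n)"
proof (rule bij_betw_byWitness [where f' = "\<lambda>\<epsilon>. {j \<in> {1..n}. \<epsilon> j = 1}"])
  show "\<forall>\<epsilon>\<in>binary_multi_indices n.
      (\<lambda>j\<in>{1..n}. if j \<in> {j \<in> {1..n}. \<epsilon> j = 1} then 1 else 0) = \<epsilon>"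
    by (fastforce simp: binary_multi_indices_def PiE_iff extensional_def)
qed (auto simp: binary_multi_indices_def split: if_splits)

lemma mi_norm_indicator:
  assumes "T \<subseteq> {1..n}"
  shows "mi_norm n (\<lambda>j\<in>{1..n}. if j \<in> T then 1 else 0) = card T"
proof -
  have "{1..n} \<inter> T = T" using assms by blast
  then show ?thesis by (simp add: mi_norm_def sum.If_cases)
qed

text \<open>Entries equal to 1 fall below the threshold of the norm, so only the doubled ones on T
  are counted.\<close>

lemma superlinear_norm_ones_add_indicator:
  assumes "T \<subseteq> {1..n}"
  shows "superlinear_norm n (mi_add n (mi_ones n) (\<lambda>j\<in>{1..n}. if j \<in> T then 1 else 0))
    = 2 * card T"
proof -
  let ?\<alpha> = "mi_add n (mi_ones n) (\<lambda>j\<in>{1..n}. if j \<in> T then 1 else 0)"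
  have "{j \<in> {1..n}. ?\<alpha> j \<ge> 2} = T"
    using assms by (auto simp: mi_add_def mi_ones_def)
  moreover have "?\<alpha> j = 2" if "j \<in> T" for j
    using that assms by (auto simp: mi_add_def mi_ones_def)
  ultimately show ?thesis by (simp add: superlinear_norm_def)
qed

theorem theorem3:
  fixes n r :: nat
  assumes "n \<ge> 1" and "r \<ge> 1" and "r < 2 * n"
  shows "interp_coeff n r (mi_ones n) = (-1) ^ (r div 2) * int ((n - 1) choose (r div 2))"
proof -
  let ?f = "\<lambda>k. (-1) ^ k * (if k \<le> r div 2 then 1 else 0) :: int"
  let ?e = "\<lambda>T. \<lambda>j\<in>{1..n}. if j \<in> T then 1 else 0 :: nat"
  have "interp_coeff n r (mi_ones n) = (\<Sum>T\<in>Pow {1..n}. (-1) ^ mi_norm n (?e T) *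
      indicator (superlinear_set n r) (mi_add n (mi_ones n) (?e T)))"
    unfolding interp_coeff_def
    by (rule sum.reindex_bij_betw [OF bij_betw_indicator_Pow, symmetric])
  also have "\<dots> = (\<Sum>T\<in>Pow {1..n}. ?f (card T))"
  proof (rule sum.cong [OF refl])
    fix T assume "T \<in> Pow {1..n}"
    then have T: "T \<subseteq> {1..n}" by simp
    have "mi_add n (mi_ones n) (?e T) \<in> multi_indices n"
      by (simp add: mi_add_def multi_indices_def)
    \<comment> \<open>Membership means 2|T| \<le> r; as |T| is an integer, r may be halved with
      rounding down.\<close>
    then have "mi_add n (mi_ones n) (?e T) \<in> superlinear_set n r \<longleftrightarrow> card T \<le> r div 2"
      unfolding superlinear_set_def mem_Collect_eq superlinear_norm_ones_add_indicator [OF T]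
      by auto
    then show "(-1) ^ mi_norm n (?e T) *
        indicator (superlinear_set n r) (mi_add n (mi_ones n) (?e T)) = ?f (card T)"
      unfolding mi_norm_indicator [OF T] indicator_def by simp
  qed
  also have "\<dots> = (\<Sum>k\<le>n. int (n choose k) * ?f k)"
    using sum_Pow_card [of "{1..n}" ?f] by simp
  \<comment> \<open>Since r < 2n, the cutoff \<open>r div 2\<close> lies below n, and the terms
    beyond it vanish.\<close>
  also have "\<dots> = (\<Sum>k\<le>r div 2. (-1) ^ k * int (n choose k))"
    using assms(3) by (intro sum.mono_neutral_cong_right) auto
  also have "\<dots> = (-1) ^ (r div 2) * int ((n - 1) choose (r div 2))"
    using assms(1) by (rule alternating_binomial_partial_sum)
  finally show ?thesis .
qed

end
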